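(* Let $\Phi:\widehat{\mathbb Z}[[x]]\to\widehat{\mathbb Z}[[x]]$, $\Phi(G)=(x-1)\frac{dG}{dx}$. The set $S=\bigcap_{r}\mathrm{Im}(\Phi^r)\subset\widehat{\mathbb Z}[[x]]$ consists of all power series $G=\sum_{i\ge0}a_ix^i$ satisfying the following property: for every prime $p$ and all positive integers $n$ and $m$ such that $m$ is divisible by $p^n$, and for every nonnegative $j<m$ divisible by $p$, the sum $\sum_{i=j}^{m-1}\binom{i}{j}a_i$ is divisible by $p^n$ (in $\widehat{\mathbb Z}$).
   Context: $\widehat{\mathbb Z}=\lim\mathbb Z/n\mathbb Z$ is the ring of profinite integers. The intersection defining $S$ is over all $r\geq 1$ and $\Phi^r$ is the $r$-fold iterate of $\Phi$. *)

theory Defs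
  imports "HOL-Computational_Algebra.Formal_Power_Series" "HOL-Computational_Algebra.Primes"
begin

text \<open>
  The ring of profinite integers, as the limit of the rings of residues modulo \<open>n\<close> over all
  \<open>n \<ge> 1\<close> ordered by divisibility. An element is a family \<open>f\<close> where \<open>f n\<close> is the canonical
  representative in \<open>{0..<n}\<close> of the component modulo \<open>n\<close>. The index \<open>0\<close> is not part of the
  limit; \<open>f 0\<close> is pinned to the junk value \<open>0\<close>.
\<close>

definition residue_families :: "(nat \<Rightarrow> int) set" where
  "residue_families =
    {f. f 0 = 0 \<and> (\<forall>n>0. f n \<in> {0..<int n}) \<and>
      (\<forall>m n. n > 0 \<longrightarrow> m dvd n \<longrightarrow> f n mod int m = f m)}"

typedef profinite_int = residue_families
  morphisms residue Abs_profinite_int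
  by (rule exI[of _ "\<lambda>_. 0"]) (auto simp: residue_families_def)

setup_lifting type_definition_profinite_int

definition reduce :: "nat \<Rightarrow> int \<Rightarrow> int" where
  "reduce n k = (if n = 0 then 0 else k mod int n)"

lemma reduce_family:
  assumes "\<And>m n. n > 0 \<Longrightarrow> m dvd n \<Longrightarrow> k n mod int m = k m mod int m"
  shows "(\<lambda>n. reduce n (k n)) \<in> residue_families"
proof -
  have "reduce n (k n) mod int m = reduce m (k m)" if "n > 0" "m dvd n" for m n
  proof -
    have "m > 0" using that by (auto intro: Nat.gr0I)
    then show ?thesis using assms[OF that] that by (simp add: reduce_def mod_mod_cancel)
  qed
  then show ?thesis by (simp add: reduce_def residue_families_def)
qed

lemma residue_families_mod:
  "f \<in> residue_families \<Longrightarrow> n > 0 \<Longrightarrow> m dvd n \<Longrightarrow> f n mod int m = f m mod int m"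
proof -
  assume f: "f \<in> residue_families" and "n > 0" "m dvd n"
  then have "f n mod int m = f m" unfolding residue_families_def by blast
  then show ?thesis by (metis mod_mod_trivial)
qed

lemma residue_families_reduce: "f \<in> residue_families \<Longrightarrow> reduce n (f n) = f n"
  by (cases "n = 0") (simp_all add: residue_families_def reduce_def)

instantiation profinite_int :: comm_ring_1
begin

lift_definition zero_profinite_int :: profinite_int is "\<lambda>n. reduce n 0"
  by (rule reduce_family) (rule refl)

lift_definition one_profinite_int :: profinite_int is "\<lambda>n. reduce n 1"
  by (rule reduce_family) (rule refl)

lift_definition plus_profinite_int :: "profinite_int \<Rightarrow> profinite_int \<Rightarrow> profinite_int"
  is "\<lambda>f g n. reduce n (f n + g n)"
  by (rule reduce_family) (blast intro: mod_add_cong residue_families_mod)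

lift_definition uminus_profinite_int :: "profinite_int \<Rightarrow> profinite_int"
  is "\<lambda>f n. reduce n (- f n)"
  by (rule reduce_family) (blast intro: mod_minus_cong residue_families_mod)

lift_definition minus_profinite_int :: "profinite_int \<Rightarrow> profinite_int \<Rightarrow> profinite_int"
  is "\<lambda>f g n. reduce n (f n - g n)"
  by (rule reduce_family) (blast intro: mod_diff_cong residue_families_mod)

lift_definition times_profinite_int :: "profinite_int \<Rightarrow> profinite_int \<Rightarrow> profinite_int"
  is "\<lambda>f g n. reduce n (f n * g n)"
  by (rule reduce_family) (blast intro: mod_mult_cong residue_families_mod)

instance
proof
  fix a b c :: profinite_int
  show "a + b + c = a + (b + c)"
    by transfer (auto simp: reduce_def fun_eq_iff mod_simps add.assoc)
  show "a + b = b + a"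
    by transfer (simp add: add.commute)
  show "0 + a = a"
  proof transfer
    fix f assume "f \<in> residue_families"
    moreover have "reduce n 0 = 0" for n
      by (simp add: reduce_def)
    ultimately show "(\<lambda>n. reduce n (reduce n 0 + f n)) = f"
      by (simp add: residue_families_reduce)
  qed
  show "- a + a = 0"
    by transfer (auto simp: reduce_def fun_eq_iff mod_simps)
  show "a - b = a + - b"
    by transfer (auto simp: reduce_def fun_eq_iff mod_simps)
  show "a * b * c = a * (b * c)"
    by transfer (auto simp: reduce_def fun_eq_iff mod_simps mult.assoc)
  show "a * b = b * a"
    by transfer (simp add: mult.commute)
  show "1 * a = a"
  proof transfer
    fix f assume "f \<in> residue_families"
    moreover have "reduce n (reduce n 1 * f n) = reduce n (f n)" for n
      by (simp add: reduce_def mod_simps)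
    ultimately show "(\<lambda>n. reduce n (reduce n 1 * f n)) = f"
      by (simp add: residue_families_reduce)
  qed
  show "(a + b) * c = a * c + b * c"
    by transfer (auto simp: reduce_def fun_eq_iff mod_simps distrib_right)
  show "(0::profinite_int) \<noteq> 1"
    by transfer (simp add: reduce_def fun_eq_iff exI[of _ 2])
qed

end

definition Phi :: "profinite_int fps \<Rightarrow> profinite_int fps" where
  "Phi G = (fps_X - 1) * fps_deriv G"

definition S :: "profinite_int fps set" where
  "S = (\<Inter>r\<in>{1::nat..}. range (Phi ^^ r))"

end

theory Submission imports Defs begin

text \<open>
  In terms of \<open>t = 1 - x\<close> the operator \<open>Phi\<close> is the Euler operator \<open>t d/dt\<close>, and it acts on series
  modulo \<open>p ^ n\<close> and \<open>x ^ m\<close> whenever \<open>p ^ n\<close> divides \<open>m\<close>. There it multiplies \<open>t ^ j\<close> by \<open>j\<close>, so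
  in the image of its \<open>n\<close>-th power the coefficients of \<open>t ^ j\<close> with \<open>p\<close> dividing \<open>j\<close> vanish. These
  coefficients are, up to sign, the sums in the theorem.

  Conversely, the sums for \<open>j = 0\<close> allow \<open>G = Phi H\<close> to be solved for \<open>H\<close> up to the constant term,
  and it suffices to find a solution with the same divisibility property. Dividing the \<open>j\<close>-th
  coefficient by \<open>j\<close> loses precision, which is regained by passing to a larger truncation: modulo
  \<open>p ^ n\<close> and \<open>x ^ m\<close>, the powers \<open>t ^ k\<close> with \<open>p\<close> not dividing \<open>k\<close> involve only \<open>t ^ j\<close> with \<open>p\<close>
  not dividing \<open>j\<close>, and those with \<open>k\<close> divisible by a high power of \<open>p\<close> are congruent to \<open>1\<close>.
  So only the constant coefficients are left, and these are compatible as \<open>m\<close> varies; the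
  completeness of the profinite integers yields a constant term of \<open>H\<close> that cancels all of them.
\<close>

section \<open>Divisibility in the profinite integers\<close>

lemma residue_mod:
  assumes "n > 0" "m dvd n"
  shows "residue z n mod int m = residue z m"
  using residue[of z] assms unfolding residue_families_def by blast

lemma residue_bounds: "n > 0 \<Longrightarrow> 0 \<le> residue z n \<and> residue z n < int n"
  using residue[of z] unfolding residue_families_def by auto

lemma residue_of_nat: "residue (of_nat k) n = reduce n (int k)"
proof (induction k)
  case 0
  show ?case by (simp add: zero_profinite_int.rep_eq)
next
  case (Suc k)
  then show ?case
    by (simp add: plus_profinite_int.rep_eq one_profinite_int.rep_eq reduce_def mod_simps)
qed

text \<open>The quotient is read off at level \<open>m * n\<close>: dividing that residue by
  \<open>m\<close> leaves precision \<open>n\<close>.\<close>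

lemma of_nat_dvd_iff_residue:
  assumes "m > 0"
  shows "of_nat m dvd z \<longleftrightarrow> residue z m = 0"
proof
  assume "of_nat m dvd z"
  then obtain w where "z = of_nat m * w" ..
  then show "residue z m = 0"
    by (simp add: times_profinite_int.rep_eq residue_of_nat reduce_def)
next
  assume z: "residue z m = 0"
  define f where "f n = residue z (m * n) div int m" for n
  have m_mult: "residue z (m * n) = int m * f n" if "n > 0" for n
    using residue_mod[of "m * n" m z] that assms z by (simp add: f_def mod_0_imp_dvd)
  have f: "f \<in> residue_families"
    unfolding residue_families_def
  proof (intro CollectI conjI allI impI)
    show "f 0 = 0"
      using residue[of z] by (simp add: f_def residue_families_def)
  next
    fix n :: nat assume "n > 0"
    then have "0 \<le> int m * f n" "int m * f n < int m * int n"
      using m_mult[of n] residue_bounds[of "m * n" z] assms by simp_all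
    then show "f n \<in> {0..<int n}"
      using assms by (simp add: zero_le_mult_iff)
  next
    fix k n :: nat assume kn: "n > 0" "k dvd n"
    then have "k > 0" by (auto intro: Nat.gr0I)
    have "int m * (f n mod int k) = residue z (m * n) mod int (m * k)"
      using m_mult[of n] kn by simp
    also have "\<dots> = int m * f k"
      using residue_mod[of "m * n" "m * k" z] m_mult[of k] kn \<open>k > 0\<close> assms by simp
    finally show "f n mod int k = f k"
      using assms by simp
  qed
  have "z = of_nat m * Abs_profinite_int f"
  proof (rule residue_inject[THEN iffD1], rule ext)
    fix n
    show "residue z n = residue (of_nat m * Abs_profinite_int f) n"
    proof (cases "n = 0")
      case True
      then show ?thesis
        using residue[of z] by (simp add: times_profinite_int.rep_eq reduce_def residue_families_def)
    next
      case False
      then show ?thesis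
        using residue_mod[of "m * n" n z] m_mult[of n] assms f
        by (simp add: times_profinite_int.rep_eq residue_of_nat reduce_def
            Abs_profinite_int_inverse mod_simps)
    qed
  qed
  then show "of_nat m dvd z" by simp
qed

text \<open>Torsion-freeness: the component of \<open>of_nat k * z\<close> at \<open>k * n\<close>
  determines that of \<open>z\<close> at \<open>n\<close>.\<close>

lemma of_nat_mult_eq_0_imp:
  fixes z :: profinite_int
  assumes "of_nat k * z = 0" "k > 0"
  shows "z = 0"
proof (rule residue_inject[THEN iffD1], rule ext)
  fix n
  show "residue z n = residue 0 n"
  proof (cases "n = 0")
    case True
    then show ?thesis
      using residue[of z] by (simp add: zero_profinite_int.rep_eq reduce_def residue_families_def)
  next
    case False
    have "residue (of_nat k * z) (k * n) = 0"
      by (simp add: assms(1) zero_profinite_int.rep_eq reduce_def)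
    then have "(int k * residue z (k * n)) mod int (k * n) = 0"
      using False assms(2)
      by (simp add: times_profinite_int.rep_eq residue_of_nat reduce_def mod_simps)
    then have "int n dvd residue z (k * n)"
      using assms(2) by (simp add: mod_eq_0_iff_dvd)
    then have "residue z n = 0"
      using residue_mod[of "k * n" n z] False assms(2) by simp
    then show ?thesis
      by (simp add: zero_profinite_int.rep_eq reduce_def)
  qed
qed

lemma of_nat_mult_left_cancel:
  fixes z w :: profinite_int
  assumes "of_nat k * z = of_nat k * w" "k > 0"
  shows "z = w"
  using of_nat_mult_eq_0_imp[of k "z - w"] assms by (simp add: algebra_simps)

text \<open>Prime valuations are compared for the natural number representing \<open>z\<close>
  modulo \<open>m\<close>.\<close>

lemma of_nat_dvd_if_prime_powers_dvd:
  fixes z :: profinite_int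
  assumes "m > 0"
    and "\<And>p n. prime p \<Longrightarrow> n > 0 \<Longrightarrow> p ^ n dvd m \<Longrightarrow> of_nat (p ^ n) dvd z"
  shows "of_nat m dvd z"
proof -
  have "m dvd nat (residue z m)"
  proof (cases "residue z m = 0")
    case False
    then have pos: "nat (residue z m) > 0"
      using residue_bounds[of m z] assms(1) by simp
    show ?thesis
    proof (rule multiplicity_le_imp_dvd)
      fix p :: nat assume p: "prime p"
      let ?n = "multiplicity p m"
      have "p ^ ?n dvd nat (residue z m)"
      proof (cases "?n = 0")
        case False
        have dvd: "p ^ ?n dvd m" by (rule multiplicity_dvd)
        have "residue z (p ^ ?n) = 0"
          using assms(2)[OF p _ dvd] False p
          by (simp add: of_nat_dvd_iff_residue[symmetric] prime_gt_0_nat)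
        then have "int (p ^ ?n) dvd residue z m"
          using residue_mod[OF assms(1) dvd, of z] by (simp add: mod_0_imp_dvd)
        then show ?thesis
          using residue_bounds[OF assms(1), of z] by (metis int_dvd_int_iff nat_0_le)
      qed simp
      then show "?n \<le> multiplicity p (nat (residue z m))"
        using p pos by (intro multiplicity_geI) auto
    qed (use assms(1) in simp)
  qed simp
  then have "residue z m = 0"
    using residue_bounds[OF assms(1), of z]
    by (metis int_nat_eq nat_dvd_not_less nat_less_iff of_nat_0 gr0I)
  then show ?thesis
    using of_nat_dvd_iff_residue[OF assms(1)] by simp
qed

text \<open>With \<open>k = p ^ s * u\<close>, cancelling \<open>p ^ s\<close> costs at most
  \<open>N - n\<close> powers of \<open>p\<close>, and \<open>u\<close> is invertible modulo
  \<open>p ^ n\<close> by Bezout.\<close>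

lemma prime_power_dvd_cancel:
  fixes z :: profinite_int
  assumes p: "prime p" and dvd: "of_nat (p ^ N) dvd of_nat k * z"
    and "k > 0" "n \<le> N" "\<not> p ^ (N - n + 1) dvd k"
  shows "of_nat (p ^ n) dvd z"
proof -
  obtain s u where k: "k = p ^ s * u" and u: "\<not> p dvd u"
    using multiplicity_decompose'[of k p] assms by (metis not_prime_unit gr_implies_not0)
  have s: "s \<le> N - n"
  proof (rule ccontr)
    assume "\<not> s \<le> N - n"
    then have "p ^ (N - n + 1) dvd p ^ s" by (intro le_imp_power_dvd) simp
    then show False using assms(5) k by (simp add: dvd_mult2)
  qed
  obtain w where "of_nat k * z = of_nat (p ^ N) * w"
    using dvd by (auto simp: dvd_def)
  moreover have "p ^ N = p ^ s * (p ^ n * p ^ (N - n - s))"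
    using s assms(4) by (simp flip: power_add)
  ultimately have "of_nat (p ^ s) * (of_nat u * z) =
      of_nat (p ^ s) * (of_nat (p ^ n) * (of_nat (p ^ (N - n - s)) * w))"
    by (simp add: k mult_ac)
  then have uz: "of_nat u * z = of_nat (p ^ n) * (of_nat (p ^ (N - n - s)) * w)"
    by (rule of_nat_mult_left_cancel) (use p in \<open>simp add: prime_gt_0_nat\<close>)
  have "coprime (int u) (int (p ^ n))"
    using p u by (simp add: prime_imp_coprime coprime_commute)
  then obtain a b where "a * int u + b * int (p ^ n) = 1"
    by (metis bezout_int coprime_iff_gcd_eq_1)
  then have "of_int (a * int u + b * int (p ^ n)) * z = z" by simp
  then have "z = of_int a * (of_nat u * z) + of_int b * (of_nat (p ^ n) * z)"
    by (simp add: algebra_simps)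
  then show ?thesis
    by (metis uz dvd_add dvd_mult dvd_triv_left)
qed

text \<open>Completeness: the diagonal residues form a compatible family.\<close>

lemma profinite_int_limit:
  fixes s :: "nat \<Rightarrow> profinite_int"
  assumes "\<And>m n. n > 0 \<Longrightarrow> m dvd n \<Longrightarrow> of_nat m dvd s n - s m"
  obtains z where "\<And>m. m > 0 \<Longrightarrow> of_nat m dvd z - s m"
proof -
  define f where "f n = reduce n (residue (s n) n)" for n
  have f: "f \<in> residue_families"
    unfolding f_def
  proof (rule reduce_family)
    fix m n :: nat assume mn: "n > 0" "m dvd n"
    then have "m > 0" by (auto intro: Nat.gr0I)
    then have "residue (s n - s m) m = 0"
      using assms[OF mn] by (simp add: of_nat_dvd_iff_residue)
    then have "residue (s n) m mod int m = residue (s m) m mod int m"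
      using \<open>m > 0\<close> by (simp add: minus_profinite_int.rep_eq reduce_def mod_eq_dvd_iff mod_0_imp_dvd)
    then show "residue (s n) n mod int m = residue (s m) m mod int m"
      using residue_mod[OF mn] by (metis mod_mod_trivial)
  qed
  have "of_nat m dvd Abs_profinite_int f - s m" if "m > 0" for m
    using that f
    by (simp add: of_nat_dvd_iff_residue minus_profinite_int.rep_eq Abs_profinite_int_inverse
        f_def reduce_def mod_simps)
  then show ?thesis by (rule that)
qed

lemma of_nat_dvd_of_nat: "m dvd n \<Longrightarrow> (of_nat m :: 'a::comm_semiring_1) dvd of_nat n"
  by (auto simp: dvd_def)

section \<open>Alternating sums of binomial coefficients\<close>

text \<open>The absorption identities make the right side telescope. It vanishes for
  \<open>m > k\<close>, and it is always a multiple of \<open>m\<close>.\<close>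

lemma choose_telescope:
  fixes k j m :: nat
  shows "(int k - int j) * (\<Sum>l<m. (-1) ^ l * int (k choose l) * int (l choose j)) =
    - ((-1) ^ m * (int m - int j) * int (k choose m) * int (m choose j))"
proof (induction m)
  case 0
  show ?case by (cases j) simp_all
next
  case (Suc m)
  have 1: "int (Suc m) * int (k choose Suc m) = (int k - int m) * int (k choose m)"
  proof (cases "m \<le> k")
    case True
    then show ?thesis
      using binomial_absorb_comp[of k m] binomial_absorption[of m k]
      by (metis of_nat_diff of_nat_mult)
  qed (simp add: binomial_eq_0)
  have 2: "(int (Suc m) - int j) * int (Suc m choose j) = int (Suc m) * int (m choose j)"
  proof (cases "j \<le> Suc m")
    case True
    then show ?thesis
      using binomial_absorb_comp[of "Suc m" j] by (metis diff_Suc_1 of_nat_diff of_nat_mult)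
  qed (simp add: binomial_eq_0)
  have absorb: "(int (Suc m) - int j) * int (k choose Suc m) * int (Suc m choose j) =
      (int k - int m) * int (k choose m) * int (m choose j)"
    using 1 2 by (metis mult.assoc mult.commute)
  let ?s = "\<lambda>m. \<Sum>l<m. (-1) ^ l * int (k choose l) * int (l choose j)"
  have "(int k - int j) * ?s (Suc m) =
      (int k - int j) * ?s m + (-1) ^ m * ((int k - int j) * int (k choose m) * int (m choose j))"
    by (simp add: algebra_simps)
  also have "\<dots> = (-1) ^ m * ((int k - int m) * int (k choose m) * int (m choose j))"
    unfolding Suc.IH by (simp add: algebra_simps)
  finally show ?case
    unfolding absorb[symmetric] by (simp add: mult.assoc)
qed

text \<open>Pascal's matrix is inverted by its signed version. Off the diagonal the telescoped sum
  contains the factor \<open>i choose M\<close>, which is zero.\<close>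

lemma choose_orthogonal:
  fixes i l M :: nat
  assumes "i < M"
  shows "(\<Sum>k<M. (-1) ^ (k + l) * int (i choose k) * int (k choose l)) = of_bool (i = l)"
proof -
  have eq: "(\<Sum>k<M. (-1) ^ (k + l) * int (i choose k) * int (k choose l)) =
      (-1) ^ l * (\<Sum>k<M. (-1) ^ k * int (i choose k) * int (k choose l))"
    by (simp add: sum_distrib_left power_add mult_ac)
  show ?thesis
  proof (cases "i = l")
    case False
    then show ?thesis
      using choose_telescope[of i l M] assms eq by (simp add: binomial_eq_0)
  next
    case True
    have "(\<Sum>k<M. (-1) ^ (k + l) * int (i choose k) * int (k choose l)) =
        (\<Sum>k\<in>{l}. (-1) ^ (k + l) * int (i choose k) * int (k choose l))"
      using assms True
      by (intro sum.mono_neutral_right) (auto simp: not_less_iff_gr_or_eq)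
    then show ?thesis using True by (simp flip: power_add mult_2)
  qed
qed

text \<open>Up to sign, \<open>k - j\<close> times the sum is a multiple of \<open>m\<close>, and
  \<open>k - j\<close> is prime to \<open>p\<close>.\<close>

lemma prime_power_dvd_alternating_sum:
  fixes p n m j k :: nat
  assumes p: "prime p" and "p ^ n dvd m" "p dvd j" "\<not> p dvd k"
  shows "int (p ^ n) dvd (\<Sum>l<m. (-1) ^ (k + l) * int (k choose l) * int (l choose j))"
proof -
  let ?s = "\<Sum>l<m. (-1) ^ l * int (k choose l) * int (l choose j)"
  have "(int m - int j) * int (m choose j) = int m * int (m - 1 choose j)"
  proof (cases "j \<le> m")
    case True
    then show ?thesis
      using binomial_absorb_comp[of m j] by (metis of_nat_diff of_nat_mult)
  qed (simp add: binomial_eq_0)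
  then have "int m dvd (int m - int j) * int (m choose j)" by simp
  then have "int m dvd (int k - int j) * ?s"
    unfolding choose_telescope
    by (simp add: dvd_mult mult.assoc mult.left_commute[of _ "int (k choose m)"])
  then have "int (p ^ n) dvd (int k - int j) * ?s"
    using assms(2) by (meson dvd_trans int_dvd_int_iff)
  moreover have "\<not> int p dvd int k - int j"
    using assms(3,4) by (simp add: dvd_diff_left_iff)
  then have "coprime (int (p ^ n)) (int k - int j)"
    using p by (simp add: prime_imp_coprime)
  ultimately have "int (p ^ n) dvd ?s"
    using coprime_dvd_mult_right_iff by blast
  moreover have "(\<Sum>l<m. (-1) ^ (k + l) * int (k choose l) * int (l choose j)) = (-1) ^ k * ?s"
    by (simp add: sum_distrib_left power_add mult_ac)
  ultimately show ?thesis by simp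
qed

text \<open>In \<open>l * (k choose l) = k * (k - 1 choose (l - 1))\<close> the factor
  \<open>l\<close> absorbs fewer than \<open>B\<close> powers of \<open>p\<close>.\<close>

lemma prime_power_dvd_choose:
  fixes p n k l B :: nat
  assumes p: "prime p" and "p ^ (n + B) dvd k" "0 < l" "l < B"
  shows "p ^ n dvd k choose l"
proof -
  obtain s u where l: "l = p ^ s * u" and u: "\<not> p dvd u"
    using multiplicity_decompose'[of l p] assms by (metis not_prime_unit gr_implies_not0)
  have "s < p ^ s" using prime_gt_1_nat[OF p] by (simp add: power_gt_expt)
  also have "p ^ s \<le> l" using l assms(3) by (cases u) auto
  finally have "s \<le> B" using assms(4) by simp
  have "l * (k choose l) = k * (k - 1 choose (l - 1))"
    using times_binomial_minus1_eq[OF assms(3)] by blast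
  then have "p ^ (n + B) dvd l * (k choose l)" using assms(2) by simp
  moreover have "p ^ s * p ^ n dvd p ^ (n + B)"
    using \<open>s \<le> B\<close> by (simp add: le_imp_power_dvd flip: power_add)
  ultimately have "p ^ s * p ^ n dvd p ^ s * (u * (k choose l))"
    using l by (metis dvd_trans mult.assoc)
  then have "p ^ n dvd u * (k choose l)" using p by (simp add: prime_gt_0_nat)
  moreover have "coprime (p ^ n) u" using p u by (simp add: prime_imp_coprime)
  ultimately show ?thesis by (simp add: coprime_dvd_mult_right_iff)
qed

section \<open>Binomial moments\<close>

text \<open>Up to the sign \<open>(-1)^j\<close>, the coefficient of \<open>t^j\<close> in the truncation of \<open>G\<close> below
  degree \<open>m\<close>, written as a polynomial in \<open>t = 1 - x\<close>.\<close>
definition moment :: "nat \<Rightarrow> nat \<Rightarrow> 'a::comm_ring_1 fps \<Rightarrow> 'a" where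
  "moment m j G = (\<Sum>i<m. of_nat (i choose j) * fps_nth G i)"

definition moment_divisible :: "'a::comm_ring_1 fps \<Rightarrow> bool" where
  "moment_divisible G \<longleftrightarrow> (\<forall>p n m j. prime p \<longrightarrow> p ^ n dvd m \<longrightarrow> j < m \<longrightarrow> p dvd j \<longrightarrow>
     of_nat (p ^ n) dvd moment m j G)"

section \<open>The operator \<open>Phi\<close> on moments\<close>

lemma Phi_nth:
  "fps_nth (Phi G) i = of_nat i * fps_nth G i - of_nat (Suc i) * fps_nth G (Suc i)"
  unfolding Phi_def by (cases i) (simp_all add: left_diff_distrib del: of_nat_Suc)

text \<open>The last term is the truncation error: \<open>Phi\<close> moves part of the omitted
  degree \<open>m\<close> term into degree \<open>m - 1\<close>.\<close>

lemma moment_Phi: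
  "moment m j (Phi H) =
    of_nat j * moment m j H - of_nat m * of_nat (m - 1 choose j) * fps_nth H m"
proof (induction m)
  case 0
  show ?case by (simp add: moment_def)
next
  case (Suc m)
  have "m * (m choose j) = j * (m choose j) + m * (m - 1 choose j)"
  proof (cases "j \<le> m")
    case True
    then have "m * (m choose j) = j * (m choose j) + (m - j) * (m choose j)"
      by (simp flip: add_mult_distrib)
    then show ?thesis by (simp add: binomial_absorb_comp)
  qed (simp add: binomial_eq_0)
  then have "of_nat m * of_nat (m choose j) =
      (of_nat j * of_nat (m choose j) + of_nat m * of_nat (m - 1 choose j) :: profinite_int)"
    by (metis of_nat_add of_nat_mult)
  then have "of_nat m * of_nat (m choose j) * fps_nth H m =
      of_nat j * of_nat (m choose j) * fps_nth H m
        + of_nat m * of_nat (m - 1 choose j) * fps_nth H m"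
    by (simp add: distrib_right)
  then show ?case
    using Suc by (simp add: moment_def Phi_nth algebra_simps)
qed

lemma dvd_moment_Phi_power:
  assumes "p ^ n dvd m" "p dvd j"
  shows "of_nat (p ^ n) dvd moment m j ((Phi ^^ n) H)"
proof -
  have "of_nat (p ^ n) dvd moment m j ((Phi ^^ r) H) - of_nat (j ^ r) * moment m j H" for r
  proof (induction r)
    case (Suc r)
    let ?G = "(Phi ^^ r) H"
    have "moment m j (Phi ?G) - of_nat (j ^ Suc r) * moment m j H =
        of_nat j * (moment m j ?G - of_nat (j ^ r) * moment m j H)
          - of_nat m * of_nat (m - 1 choose j) * fps_nth ?G m"
      by (simp add: moment_Phi algebra_simps)
    moreover have "of_nat (p ^ n) dvd (of_nat m :: profinite_int)"
      using assms(1) by (rule of_nat_dvd_of_nat)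
    ultimately show ?case
      using Suc by (simp add: dvd_mult2 dvd_diff)
  qed simp
  moreover have "of_nat (p ^ n) dvd (of_nat (j ^ n) :: profinite_int)"
    using assms(2) by (intro of_nat_dvd_of_nat dvd_power_same)
  ultimately show ?thesis
    by (metis dvd_add dvd_mult2 diff_add_cancel)
qed

text \<open>The sums over \<open>l\<close> are the coefficients of \<open>f\<close>, cut off at
  \<open>B\<close>, in the basis of functions \<open>i choose k\<close>.\<close>

lemma moment_inversion:
  fixes H :: "'a::comm_ring_1 fps" and f :: "nat \<Rightarrow> int"
  assumes "B \<le> M"
  shows "(\<Sum>i<B. of_int (f i) * fps_nth H i) =
    (\<Sum>k<M. of_int (\<Sum>l<B. (-1) ^ (k + l) * int (k choose l) * f l) * moment M k H)"
proof -
  have inner: "(\<Sum>k<M. (\<Sum>l<B. (-1) ^ (k + l) * int (k choose l) * f l) * int (i choose k)) =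
      (if i < B then f i else 0)" if "i < M" for i
  proof -
    have "(\<Sum>k<M. (\<Sum>l<B. (-1) ^ (k + l) * int (k choose l) * f l) * int (i choose k)) =
        (\<Sum>l<B. f l * (\<Sum>k<M. (-1) ^ (k + l) * int (i choose k) * int (k choose l)))"
      by (simp add: sum_distrib_left sum_distrib_right mult_ac sum.swap[of _ "{..<B}"])
    also have "\<dots> = (\<Sum>l<B. if i = l then f l else 0)"
      by (intro sum.cong) (simp_all add: choose_orthogonal[OF that])
    also have "\<dots> = (if i < B then f i else 0)"
      by simp
    finally show ?thesis .
  qed
  have "(\<Sum>k<M. of_int (\<Sum>l<B. (-1) ^ (k + l) * int (k choose l) * f l) * moment M k H) =
      (\<Sum>i<M. of_int (\<Sum>k<M. (\<Sum>l<B. (-1) ^ (k + l) * int (k choose l) * f l)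
        * int (i choose k)) * fps_nth H i)"
    unfolding moment_def sum_distrib_left of_int_sum sum_distrib_right
    by (subst sum.swap) (simp add: sum_distrib_left sum_distrib_right mult_ac)
  also have "\<dots> = (\<Sum>i<M. if i < B then of_int (f i) * fps_nth H i else 0)"
    by (intro sum.cong) (simp_all add: inner)
  also have "\<dots> = (\<Sum>i<B. of_int (f i) * fps_nth H i)"
    using assms by (intro sum.mono_neutral_cong_right) auto
  finally show ?thesis ..
qed

text \<open>Expand \<open>f\<close> in binomial coefficients \<open>k\<close> below a large power \<open>M\<close> of \<open>p\<close>. The terms with
  \<open>p\<close> not dividing \<open>k\<close> vanish modulo \<open>p ^ n\<close> by hypothesis. If \<open>k\<close> has moderate valuation, then
  \<open>k * moment M k H \<equiv> moment M k (Phi H) \<equiv> 0\<close> modulo \<open>M\<close> can be divided by \<open>k\<close>; if it has large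
  valuation, the coefficient of \<open>f\<close> vanishes since \<open>f 0 = 0\<close>.\<close>
lemma dvd_weighted_sum:
  fixes H :: "profinite_int fps" and f :: "nat \<Rightarrow> int"
  assumes p: "prime p" and H: "moment_divisible (Phi H)" and f0: "f 0 = 0"
    and f: "\<And>k. \<not> p dvd k \<Longrightarrow>
      int (p ^ n) dvd (\<Sum>l<B. (-1) ^ (k + l) * int (k choose l) * f l)"
  shows "of_nat (p ^ n) dvd (\<Sum>i<B. of_int (f i) * fps_nth H i)"
proof -
  \<comment> \<open>Dividing by \<open>k\<close> of valuation at most \<open>N - n = n + B\<close>
    leaves \<open>n\<close> powers of \<open>p\<close>; any higher valuation meets the bound of
    \<open>prime_power_dvd_choose\<close>.\<close>
  define N where "N = n + n + B"
  define M where "M = p ^ N"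
  let ?c = "\<lambda>k. \<Sum>l<B. (-1) ^ (k + l) * int (k choose l) * f l"
  have "N < M" unfolding M_def using prime_gt_1_nat[OF p] by (simp add: power_gt_expt)
  then have BM: "B \<le> M" by (simp add: N_def)
  have of_c: "of_nat (p ^ n) dvd (of_int (?c k) * y :: profinite_int)"
    if "int (p ^ n) dvd ?c k" for k y
  proof -
    from that obtain t where "?c k = int (p ^ n) * t" ..
    then show ?thesis by (simp only: of_int_mult of_int_of_nat_eq mult.assoc dvd_triv_left)
  qed
  have "of_nat (p ^ n) dvd of_int (?c k) * moment M k H" if "k < M" for k
  proof -
    consider "\<not> p dvd k" | "k = 0" | "p dvd k" "k > 0" "\<not> p ^ (N - n + 1) dvd k"
      | "p ^ (N - n + 1) dvd k" by blast
    then show ?thesis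
    proof cases
      case 1
      then show ?thesis by (intro of_c f)
    next
      case 2
      have "?c 0 = 0"
        using f0 by (intro sum.neutral) (auto simp: binomial_eq_0_iff intro: Nat.gr0I)
      then show ?thesis using 2 by simp
    next
      case 3
      have "of_nat (p ^ N) dvd moment M k (Phi H)"
        using H[unfolded moment_divisible_def, rule_format, OF p _ that] 3(1) by (simp add: M_def)
      moreover have "of_nat k * moment M k H =
          moment M k (Phi H) + of_nat (p ^ N) * (of_nat (M - 1 choose k) * fps_nth H M)"
        by (simp add: moment_Phi M_def mult.assoc)
      ultimately have "of_nat (p ^ N) dvd of_nat k * moment M k H"
        by (simp add: dvd_add)
      then have "of_nat (p ^ n) dvd moment M k H"
        by (rule prime_power_dvd_cancel[OF p _ 3(2) _ 3(3)]) (simp add: N_def)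
      then show ?thesis by simp
    next
      case 4
      have "p ^ (n + B) dvd p ^ (N - n + 1)"
        by (intro le_imp_power_dvd) (simp add: N_def)
      then have k: "p ^ (n + B) dvd k" using 4 by (rule dvd_trans)
      have "int (p ^ n) dvd ?c k"
      proof (rule dvd_sum)
        fix l assume "l \<in> {..<B}"
        show "int (p ^ n) dvd (-1) ^ (k + l) * int (k choose l) * f l"
        proof (cases "l = 0")
          case False
          then have "int (p ^ n) dvd int (k choose l)"
            using prime_power_dvd_choose[OF p k, of l] \<open>l \<in> {..<B}\<close>
            by (simp only: int_dvd_int_iff) simp
          then show ?thesis by (simp only: dvd_mult dvd_mult2)
        qed (simp add: f0)
      qed
      then show ?thesis by (rule of_c)
    qed
  qed
  then show ?thesis
    unfolding moment_inversion[OF BM] by (intro dvd_sum) simp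
qed

lemma dvd_moment_positive:
  assumes "prime p" "moment_divisible (Phi H)" "p ^ n dvd m" "p dvd j" "j > 0"
  shows "of_nat (p ^ n) dvd moment m j H"
proof -
  have "of_nat (p ^ n) dvd (\<Sum>i<m. of_int (int (i choose j)) * fps_nth H i)"
    by (rule dvd_weighted_sum) (use assms prime_power_dvd_alternating_sum in auto)
  then show ?thesis by (simp add: moment_def)
qed

text \<open>The weight is the indicator of \<open>m \<le> i\<close>, zero at \<open>0\<close> since
  \<open>m > 0\<close>; its coefficients are differences of two alternating sums with
  \<open>j = 0\<close>.\<close>

lemma dvd_moment_0_diff:
  assumes "prime p" "moment_divisible (Phi H)" "p ^ n dvd m" "m dvd m'" "m > 0" "m' > 0"
  shows "of_nat (p ^ n) dvd moment m' 0 H - moment m 0 H"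
proof -
  have le: "m \<le> m'" using assms by (simp add: dvd_imp_le)
  have split: "(\<Sum>i<m'. g i) = (\<Sum>i<m. g i) + (\<Sum>i<m'. of_bool (m \<le> i) * g i)"
    for g :: "nat \<Rightarrow> 'b::comm_ring_1"
  proof -
    have "(\<Sum>i<m. g i) = (\<Sum>i<m'. of_bool (i < m) * g i)"
      using le by (intro sum.mono_neutral_cong_left) auto
    then show ?thesis
      by (simp flip: sum.distrib add: of_bool_def if_distrib cong: if_cong)
        (intro sum.cong, auto)
  qed
  have "of_nat (p ^ n) dvd (\<Sum>i<m'. of_int (of_bool (m \<le> i)) * fps_nth H i)"
  proof (rule dvd_weighted_sum[OF assms(1,2)])
    fix k assume k: "\<not> p dvd k"
    let ?s = "\<lambda>m. \<Sum>l<m. (-1) ^ (k + l) * int (k choose l)"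
    have "int (p ^ n) dvd ?s m" "int (p ^ n) dvd ?s m'"
      using prime_power_dvd_alternating_sum[OF assms(1) _ _ k, where j = 0] assms(3,4)
      by (auto dest: dvd_trans)
    then have "int (p ^ n) dvd ?s m' - ?s m" by (rule dvd_diff[rotated])
    then show "int (p ^ n) dvd (\<Sum>l<m'. (-1) ^ (k + l) * int (k choose l) * of_bool (m \<le> l))"
      using split[of "\<lambda>l. (-1) ^ (k + l) * int (k choose l)"] by (simp add: mult.commute)
  qed (use assms in simp)
  then show ?thesis
    using split[of "fps_nth H"] by (simp add: moment_def)
qed

section \<open>Preimages under \<open>Phi\<close> and the description of \<open>S\<close>\<close>

lemma moment_divisible_of_nat_dvd_sum:
  fixes G :: "profinite_int fps"
  assumes "moment_divisible G" "m > 0"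
  shows "of_nat m dvd (\<Sum>i<m. fps_nth G i)"
proof (rule of_nat_dvd_if_prime_powers_dvd[OF assms(2)])
  fix p n :: nat assume "prime p" "p ^ n dvd m"
  then have "of_nat (p ^ n) dvd moment m 0 G"
    using assms unfolding moment_divisible_def by simp
  then show "of_nat (p ^ n) dvd (\<Sum>i<m. fps_nth G i)"
    by (simp add: moment_def)
qed

lemma moment_divisible_imp_Phi_preimage:
  assumes G: "moment_divisible G"
  obtains H where "Phi H = G" "moment_divisible H"
proof -
  have "\<exists>h. (\<Sum>l<Suc i. fps_nth G l) = of_nat (Suc i) * h" for i
    using moment_divisible_of_nat_dvd_sum[OF G, of "Suc i"] by (auto simp only: dvd_def)
  then obtain h where h: "\<And>i. (\<Sum>l<Suc i. fps_nth G l) = of_nat (Suc i) * h i"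
    by metis
  \<comment> \<open>Summing \<open>Phi_nth\<close> telescopes, so the partial sums of
    \<open>G\<close> fix every coefficient but the constant one.\<close>
  define H where "H c = Abs_fps (\<lambda>i. case i of 0 \<Rightarrow> c | Suc i \<Rightarrow> - h i)" for c
  have H: "of_nat i * fps_nth (H c) i = - (\<Sum>l<i. fps_nth G l)" for c i
    by (cases i) (simp_all add: H_def h del: sum.lessThan_Suc of_nat_Suc)
  have Phi_H: "Phi (H c) = G" for c
    by (rule fps_ext) (simp add: Phi_nth H del: of_nat_Suc)
  \<comment> \<open>For \<open>m > 0\<close>, the zeroth moment of \<open>H c\<close> is divisible
    by \<open>m\<close> exactly when \<open>c\<close> is congruent to \<open>s m\<close>.\<close>
  define s where "s m = - moment m 0 (H 0)" for m
  have "of_nat m dvd s m' - s m" if "m' > 0" "m dvd m'" for m m'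
  proof (rule of_nat_dvd_if_prime_powers_dvd)
    show "m > 0" using that by (auto intro: Nat.gr0I)
    fix p n :: nat assume "prime p" "p ^ n dvd m"
    then have "of_nat (p ^ n) dvd moment m' 0 (H 0) - moment m 0 (H 0)"
      using that \<open>m > 0\<close> G by (intro dvd_moment_0_diff) (simp_all add: Phi_H)
    then show "of_nat (p ^ n) dvd s m' - s m"
      unfolding s_def by (metis dvd_minus_iff minus_diff_minus)
  qed
  then obtain c where c: "\<And>m. m > 0 \<Longrightarrow> of_nat m dvd c - s m"
    using profinite_int_limit[of s] by blast
  have moment_0: "moment m 0 (H c) = c - s m" if m: "m > 0" for m
  proof -
    obtain m' where "m = Suc m'" using m by (cases m) auto
    then show ?thesis
      by (simp add: moment_def s_def H_def sum.lessThan_Suc_shift del: sum.lessThan_Suc)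
  qed
  have "moment_divisible (H c)"
    unfolding moment_divisible_def
  proof (intro allI impI)
    fix p n m j :: nat assume *: "prime p" "p ^ n dvd m" "j < m" "p dvd j"
    show "of_nat (p ^ n) dvd moment m j (H c)"
    proof (cases "j = 0")
      case True
      then have "of_nat m dvd moment m j (H c)" using c[of m] moment_0[of m] * by simp
      then show ?thesis using of_nat_dvd_of_nat[OF *(2)] by (rule dvd_trans[rotated])
    next
      case False
      then show ?thesis using * G by (intro dvd_moment_positive) (simp_all add: Phi_H)
    qed
  qed
  with Phi_H show ?thesis by (rule that)
qed

lemma moment_divisible_in_range_Phi_power:
  "moment_divisible G \<Longrightarrow> G \<in> range (Phi ^^ r)"
proof (induction r arbitrary: G)
  case (Suc r)
  obtain H where H: "Phi H = G" "moment_divisible H"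
    using moment_divisible_imp_Phi_preimage[OF Suc.prems] .
  then obtain K where "H = (Phi ^^ r) K" using Suc.IH by blast
  then have "G = (Phi ^^ Suc r) K" using H(1) by simp
  then show ?case by blast
qed simp

lemma S_eq_moment_divisible: "S = {G. moment_divisible G}"
proof (intro equalityI subsetI CollectI)
  fix G :: "profinite_int fps" assume G: "G \<in> S"
  show "moment_divisible G"
    unfolding moment_divisible_def
  proof (intro allI impI)
    fix p n m j :: nat assume *: "p ^ n dvd m" "p dvd j"
    show "of_nat (p ^ n) dvd moment m j G"
    proof (cases "n = 0")
      case False
      then obtain H where "G = (Phi ^^ n) H" using G by (force simp: S_def)
      then show ?thesis using dvd_moment_Phi_power[OF *] by simp
    qed simp
  qed
next
  fix G :: "profinite_int fps" assume "G \<in> {G. moment_divisible G}"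
  then show "G \<in> S" unfolding S_def using moment_divisible_in_range_Phi_power by blast
qed

lemma moment_eq_sum_atLeastAtMost:
  "j < m \<Longrightarrow> moment m j G = (\<Sum>i=j..m-1. of_nat (i choose j) * fps_nth G i)"
  unfolding moment_def by (intro sum.mono_neutral_right) (auto simp: binomial_eq_0)

theorem theorem6p10:
  "S = {G :: profinite_int fps.
          \<forall>(p::nat) (n::nat) (m::nat). prime p \<longrightarrow> n > 0 \<longrightarrow> m > 0 \<longrightarrow> p ^ n dvd m \<longrightarrow>
            (\<forall>j<m. p dvd j \<longrightarrow>
              (of_nat (p ^ n) :: profinite_int) dvd
                (\<Sum>i=j..m-1. of_nat (i choose j) * fps_nth G i))}"
proof -
  \<comment> \<open>The conditions differ only at \<open>n = 0\<close>, where the divisor is 1, and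
    at \<open>m = 0\<close>, where no \<open>j < m\<close> exists.\<close>
  have "moment_divisible G \<longleftrightarrow>
      (\<forall>p n m. prime p \<longrightarrow> n > 0 \<longrightarrow> m > 0 \<longrightarrow> p ^ n dvd m \<longrightarrow>
        (\<forall>j<m. p dvd j \<longrightarrow> of_nat (p ^ n) dvd moment m j G))" for G :: "profinite_int fps"
    unfolding moment_divisible_def
    by (metis gr0I gr_implies_not0 of_nat_1 one_dvd power_0)
  then show ?thesis
    unfolding S_eq_moment_divisible
    by (intro Collect_cong) (simp add: moment_eq_sum_atLeastAtMost del: of_nat_power)
qed

end
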